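(* Let $a$ be a nonnegative integer with binary expansion $a=\sum_{n\ge 0} a_n 2^n$, $a_n\in\{0,1\}$ (so $a_n=0$ for all large $n$). Let $S$ be the left shift on $l^1(\mathbb{Z})$, $(Su)(d)=u(d+1)$, let $Id$ be the identity operator and $\delta_0\in l^1(\mathbb{Z})$ the Dirac mass at $0$. Define the $2\times 2$ matrices of operators on $l^1(\mathbb{Z})$ $$A_0=\begin{pmatrix} Id & \tfrac12 S^{-1}\\ 0 & \tfrac12 S\end{pmatrix},\qquad A_1=\begin{pmatrix} \tfrac12 S^{-1} & 0\\ \tfrac12 S & Id\end{pmatrix},$$ acting on column vectors in $l^1(\mathbb{Z})^2$. Then $\mu_a$ is given by the infinite product $$\mu_a=(Id,\;Id)\cdots A_{a_n}A_{a_{n-1}}\cdots A_{a_1}A_{a_0}\begin{pmatrix}\delta_0\\0\end{pmatrix},$$ in the sense that for every $d\in\mathbb{Z}$, $$\mu_a(d)=\lim_{n\to\infty}\Big((Id,\;Id)\,A_{a_n}A_{a_{n-1}}\cdots A_{a_0}\begin{pmatrix}\delta_0\\0\end{pmatrix}\Big)(d).$$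
   Context: For $x\in\mathbb{N}$ with binary expansion $x=\sum_k x_k2^k$, $s_2(x)=\sum_k x_k$ is the number of digits $1$. For $a\in\mathbb{N}$ and $d\in\mathbb{Z}$, $\mu_a(d)=\lim_{N\to\infty}\frac1N\#\{x\in\mathbb{N}: x\le N,\ s_2(x+a)-s_2(x)=d\}$ (this limit exists); $\mu_a$ is a probability measure on $\mathbb{Z}$, identified with an element of $l^1(\mathbb{Z})$. $(Id,Id)$ maps a column vector $(u,v)^T$ to $u+v$. *)

theory Defs
  imports "HOL-Analysis.Analysis"
begin

subsection \<open>The normed space of absolutely summable families indexed by the integers\<close>

typedef l1Z = "{u :: int \<Rightarrow> real. (\<lambda>d. \<bar>u d\<bar>) summable_on UNIV}"
  morphisms l1_nth Abs_l1Z
  by (rule exI[of _ "\<lambda>_. 0"]) simp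

setup_lifting type_definition_l1Z

lemma l1_nth_abs_summable: "(\<lambda>d. \<bar>l1_nth u d\<bar>) summable_on UNIV"
  using l1_nth[of u] by simp

lemma abs_summable_add:
  fixes u v :: "int \<Rightarrow> real"
  assumes "(\<lambda>d. \<bar>u d\<bar>) summable_on UNIV" "(\<lambda>d. \<bar>v d\<bar>) summable_on UNIV"
  shows "(\<lambda>d. \<bar>u d + v d\<bar>) summable_on UNIV"
  using Infinite_Sum.abs_summable_on_comparison_test'[OF summable_on_add[OF assms],
      of "\<lambda>d. u d + v d"] by (simp add: abs_triangle_ineq)

instantiation l1Z :: real_normed_vector
begin

lift_definition zero_l1Z :: l1Z is "\<lambda>_. 0" by simp

lift_definition plus_l1Z :: "l1Z \<Rightarrow> l1Z \<Rightarrow> l1Z" is "\<lambda>u v d. u d + v d"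
  by (rule abs_summable_add)

lift_definition uminus_l1Z :: "l1Z \<Rightarrow> l1Z" is "\<lambda>u d. - u d" by simp

lift_definition minus_l1Z :: "l1Z \<Rightarrow> l1Z \<Rightarrow> l1Z" is "\<lambda>u v d. u d - v d"
proof -
  fix u v :: "int \<Rightarrow> real"
  assume "(\<lambda>d. \<bar>u d\<bar>) summable_on UNIV" "(\<lambda>d. \<bar>v d\<bar>) summable_on UNIV"
  then show "(\<lambda>d. \<bar>u d - v d\<bar>) summable_on UNIV"
    using abs_summable_add[of u "\<lambda>d. - v d"] by simp
qed

lift_definition scaleR_l1Z :: "real \<Rightarrow> l1Z \<Rightarrow> l1Z" is "\<lambda>r u d. r * u d"
  by (simp add: abs_mult summable_on_cmult_right)

lift_definition norm_l1Z :: "l1Z \<Rightarrow> real" is "\<lambda>u. \<Sum>\<^sub>\<infinity>d. \<bar>u d\<bar>" .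

definition dist_l1Z :: "l1Z \<Rightarrow> l1Z \<Rightarrow> real"
  where "dist_l1Z u v = norm (u - v)"

definition sgn_l1Z :: "l1Z \<Rightarrow> l1Z"
  where "sgn_l1Z u = inverse (norm u) *\<^sub>R u"

definition uniformity_l1Z :: "(l1Z \<times> l1Z) filter"
  where "uniformity_l1Z = (INF e\<in>{0 <..}. principal {(x, y). dist x y < e})"

definition open_l1Z :: "l1Z set \<Rightarrow> bool"
  where "open_l1Z U = (\<forall>x\<in>U. \<forall>\<^sub>F (x', y) in uniformity. x' = x \<longrightarrow> y \<in> U)"

instance
proof
  fix u v w :: l1Z and r s :: real and U :: "l1Z set"
  show "u + v + w = u + (v + w)" by transfer (simp add: algebra_simps)
  show "u + v = v + u" by transfer (simp add: algebra_simps)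
  show "0 + u = u" by transfer simp
  show "- u + u = 0" by transfer simp
  show "u - v = u + - v" by transfer simp
  show "r *\<^sub>R (u + v) = r *\<^sub>R u + r *\<^sub>R v" by transfer (simp add: algebra_simps)
  show "(r + s) *\<^sub>R u = r *\<^sub>R u + s *\<^sub>R u" by transfer (simp add: algebra_simps)
  show "r *\<^sub>R s *\<^sub>R u = (r * s) *\<^sub>R u" by transfer (simp add: algebra_simps)
  show "1 *\<^sub>R u = u" by transfer simp
  show "dist u v = norm (u - v)" by (rule dist_l1Z_def)
  show "sgn u = inverse (norm u) *\<^sub>R u" by (rule sgn_l1Z_def)
  show "(uniformity :: (l1Z \<times> l1Z) filter) = (INF e\<in>{0 <..}. principal {(x, y). dist x y < e})"
    by (rule uniformity_l1Z_def)
  show "open U = (\<forall>x\<in>U. \<forall>\<^sub>F (x', y) in uniformity. x' = x \<longrightarrow> y \<in> U)"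
    by (rule open_l1Z_def)
  show "(norm u = 0) = (u = 0)"
  proof
    assume "norm u = 0"
    then have "(\<Sum>\<^sub>\<infinity>d. \<bar>l1_nth u d\<bar>) = 0" by (simp add: norm_l1Z.rep_eq)
    then have "\<bar>l1_nth u d\<bar> = 0" for d
      by (intro nonneg_infsum_le_0D[of "\<lambda>d. \<bar>l1_nth u d\<bar>" UNIV]) (auto simp: l1_nth_abs_summable)
    then show "u = 0"
      by (simp add: l1_nth_inject[symmetric] zero_l1Z.rep_eq fun_eq_iff)
  qed (simp add: norm_l1Z.rep_eq zero_l1Z.rep_eq)
  show "norm (u + v) \<le> norm u + norm v"
  proof -
    have "norm (u + v) = (\<Sum>\<^sub>\<infinity>d. \<bar>l1_nth u d + l1_nth v d\<bar>)"
      by (simp add: norm_l1Z.rep_eq plus_l1Z.rep_eq)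
    also have "\<dots> \<le> (\<Sum>\<^sub>\<infinity>d. \<bar>l1_nth u d\<bar> + \<bar>l1_nth v d\<bar>)"
      using l1_nth_abs_summable[of "u + v"]
      by (intro infsum_mono summable_on_add l1_nth_abs_summable) (auto simp: plus_l1Z.rep_eq)
    also have "\<dots> = norm u + norm v"
      by (simp add: norm_l1Z.rep_eq infsum_add l1_nth_abs_summable)
    finally show ?thesis .
  qed
  show "norm (r *\<^sub>R u) = \<bar>r\<bar> * norm u"
    by (simp add: norm_l1Z.rep_eq scaleR_l1Z.rep_eq abs_mult infsum_cmult_right')
qed

end

lift_definition delta0 :: l1Z is "\<lambda>d. if d = 0 then 1 else 0"
  by (rule iffD1[OF summable_on_cong_neutral[of UNIV "{0}" _ "\<lambda>_. 1"]]) auto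


subsection \<open>The shift and matrices of bounded operators\<close>

lemma summable_on_shift:
  fixes u :: "int \<Rightarrow> real"
  shows "(\<lambda>d. u (d + c)) summable_on UNIV \<longleftrightarrow> u summable_on UNIV"
  by (rule summable_on_reindex_bij_betw) (rule bij_betwI[of _ _ _ "\<lambda>d. d - c"], auto)

lemma infsum_shift:
  fixes u :: "int \<Rightarrow> real"
  shows "(\<Sum>\<^sub>\<infinity>d. u (d + c)) = (\<Sum>\<^sub>\<infinity>d. u d)"
  by (rule infsum_reindex_bij_betw) (rule bij_betwI[of _ _ _ "\<lambda>d. d - c"], auto)

lift_definition translate :: "int \<Rightarrow> l1Z \<Rightarrow> l1Z" is "\<lambda>c u d. u (d + c)"
  using summable_on_shift[of "\<lambda>d. \<bar>_ d\<bar>"] by simp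

lemma bounded_linear_translate: "bounded_linear (translate c)"
proof (rule bounded_linear_intro[where K = 1])
  fix u v :: l1Z and r :: real
  show "translate c (u + v) = translate c u + translate c v" by transfer simp
  show "translate c (r *\<^sub>R u) = r *\<^sub>R translate c u" by transfer simp
  show "norm (translate c u) \<le> norm u * 1"
    using infsum_shift[of "\<lambda>d. \<bar>l1_nth u d\<bar>"]
    by (simp add: norm_l1Z.rep_eq translate.rep_eq)
qed

lift_definition shift :: "l1Z \<Rightarrow>\<^sub>L l1Z" is "translate 1"
  by (rule bounded_linear_translate)

lift_definition shift_inv :: "l1Z \<Rightarrow>\<^sub>L l1Z" is "translate (- 1)"
  by (rule bounded_linear_translate)

lemma l1_nth_shift: "l1_nth (shift u) d = l1_nth u (d + 1)"
  by (simp add: shift.rep_eq translate.rep_eq)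

lemma l1_nth_shift_inv: "l1_nth (shift_inv u) d = l1_nth u (d - 1)"
  by (simp add: shift_inv.rep_eq translate.rep_eq)

lemma shift_inv_inverse:
  "shift o\<^sub>L shift_inv = id_blinfun" "shift_inv o\<^sub>L shift = id_blinfun"
  by (rule blinfun_eqI, simp add: l1_nth_inject[symmetric] fun_eq_iff l1_nth_shift l1_nth_shift_inv)+

type_synonym op_matrix = "(l1Z \<Rightarrow>\<^sub>L l1Z)^2^2"

definition op_mult :: "op_matrix \<Rightarrow> op_matrix \<Rightarrow> op_matrix"  (infixl \<open>\<odot>\<close> 70)
  where "A \<odot> B = (\<chi> i j. \<Sum>k\<in>UNIV. (A $ i $ k) o\<^sub>L (B $ k $ j))"

definition op_apply :: "op_matrix \<Rightarrow> l1Z^2 \<Rightarrow> l1Z^2"  (infixr \<open>\<odot>v\<close> 65)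
  where "A \<odot>v w = (\<chi> i. \<Sum>j\<in>UNIV. (A $ i $ j) (w $ j))"

lemma op_apply_mult: "(A \<odot> B) \<odot>v w = A \<odot>v (B \<odot>v w)"
  by (simp add: op_apply_def op_mult_def vec_eq_iff sum_2 blinfun.add_left blinfun.add_right algebra_simps)

definition row_Id_Id :: "l1Z^2 \<Rightarrow> l1Z"
  where "row_Id_Id w = w $ 1 + w $ 2"

definition A0 :: op_matrix
  where "A0 = vector [vector [id_blinfun, (1/2) *\<^sub>R shift_inv],
                      vector [0,          (1/2) *\<^sub>R shift]]"

definition A1 :: op_matrix
  where "A1 = vector [vector [(1/2) *\<^sub>R shift_inv, 0],
                      vector [(1/2) *\<^sub>R shift,     id_blinfun]]"

definition A_digit :: "nat \<Rightarrow> nat \<Rightarrow> op_matrix"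
  where "A_digit a n = (if bit a n then A1 else A0)"

primrec A_prod :: "nat \<Rightarrow> nat \<Rightarrow> op_matrix"
  where
    "A_prod a 0 = A_digit a 0"
  | "A_prod a (Suc n) = A_digit a (Suc n) \<odot> A_prod a n"


subsection \<open>The sum of binary digits and the densities\<close>

definition s2 :: "nat \<Rightarrow> nat"
  where "s2 x = card {k. bit x k}"

definition mu :: "nat \<Rightarrow> int \<Rightarrow> real"
  where "mu a d = lim (\<lambda>N. real (card {x. x \<le> N \<and> int (s2 (x + a)) - int (s2 x) = d}) / real N)"

lemma finite_bit_nat: "finite {k. bit (x::nat) k}"
proof (rule finite_subset)
  show "{k. bit x k} \<subseteq> {..<x}"
  proof
    fix k assume "k \<in> {k. bit x k}"
    then have "x div 2 ^ k \<noteq> 0" by (auto simp: bit_iff_odd intro!: Nat.gr0I)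
    then have "2 ^ k \<le> x" by (metis div_less not_le)
    then show "k \<in> {..<x}" using less_exp[of k] by (simp del: less_exp)
  qed
qed simp

lemma s2_0 [simp]: "s2 0 = 0"
  by (simp add: s2_def)

lemma s2_double [simp]: "s2 (2 * x) = s2 x"
proof -
  have "{k. bit (2 * x) k} = Suc ` {k. bit x k}"
  proof (rule set_eqI)
    fix k show "k \<in> {k. bit (2 * x) k} \<longleftrightarrow> k \<in> Suc ` {k. bit x k}"
      by (cases k) (auto simp: bit_Suc bit_0)
  qed
  then show ?thesis by (simp add: s2_def card_image)
qed

lemma s2_double_Suc [simp]: "s2 (Suc (2 * x)) = Suc (s2 x)"
proof -
  have "{k. bit (Suc (2 * x)) k} = insert 0 (Suc ` {k. bit x k})"
  proof (rule set_eqI)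
    fix k show "k \<in> {k. bit (Suc (2 * x)) k} \<longleftrightarrow> k \<in> insert 0 (Suc ` {k. bit x k})"
      by (cases k) (auto simp: bit_Suc bit_0)
  qed
  then show ?thesis
    using finite_bit_nat[of x] by (simp add: s2_def card_image)
qed

definition has_density :: "(nat \<Rightarrow> bool) \<Rightarrow> real \<Rightarrow> bool"
  where "has_density P l \<longleftrightarrow> (\<lambda>N. real (card {x. x \<le> N \<and> P x}) / real N) \<longlonglongrightarrow> l"

lemma has_density_False: "has_density (\<lambda>_. False) 0"
  by (simp add: has_density_def)

lemma has_density_True: "has_density (\<lambda>_. True) 1"
proof -
  have "(\<lambda>N. 1 + inverse (real N)) \<longlonglongrightarrow> 1 + 0"
    by (intro tendsto_intros LIMSEQ_inverse_real_of_nat lim_inverse_n)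
  moreover have "\<forall>\<^sub>F N in sequentially. 1 + inverse (real N) = real (Suc N) / real N"
    using eventually_gt_at_top[of 0] by eventually_elim (simp add: field_simps)
  ultimately have "(\<lambda>N. real (Suc N) / real N) \<longlonglongrightarrow> 1"
    by (simp add: Lim_transform_eventually)
  moreover have "{x. x \<le> N} = {..N}" for N :: nat by auto
  ultimately show ?thesis by (simp add: has_density_def)
qed

lemma has_density_split:
  assumes "has_density (\<lambda>y. P (2 * y)) l" "has_density (\<lambda>y. P (Suc (2 * y))) m"
  shows "has_density P ((l + m) / 2)"
proof -
  define f where "f N = real (card {y. y \<le> N \<and> P (2 * y)})" for N
  define g where "g N = real (card {y. y \<le> N \<and> P (Suc (2 * y))})" for N
  have half: "(\<lambda>N. h (N div 2) / real N) \<longlonglongrightarrow> L / 2"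
    if h: "(\<lambda>N. h N / real N) \<longlonglongrightarrow> L" for h :: "nat \<Rightarrow> real" and L
  proof -
    have top: "filterlim (\<lambda>N::nat. N div 2) at_top sequentially"
      unfolding filterlim_at_top
    proof
      fix Z :: nat
      show "\<forall>\<^sub>F N in sequentially. Z \<le> N div 2"
        using eventually_ge_at_top[of "2 * Z"] by eventually_elim linarith
    qed
    have "(\<lambda>N. h (N div 2) / real (N div 2)) \<longlonglongrightarrow> L"
      using filterlim_compose[OF h top] by simp
    moreover have "(\<lambda>N. real (N div 2) / real N) \<longlonglongrightarrow> 1 / 2"
    proof (rule tendsto_sandwich)
      show "\<forall>\<^sub>F N in sequentially. 1 / 2 - inverse (real N) \<le> real (N div 2) / real N"
        using eventually_gt_at_top[of 0]
      proof eventually_elim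
        case (elim N)
        have "real N - 2 \<le> 2 * real (N div 2)" by linarith
        then have "(real N - 2) / real N \<le> 2 * real (N div 2) / real N"
          by (rule divide_right_mono) simp
        with elim show ?case by (simp add: diff_divide_distrib inverse_eq_divide)
      qed
      show "\<forall>\<^sub>F N in sequentially. real (N div 2) / real N \<le> 1 / 2"
        using eventually_gt_at_top[of 0]
      proof eventually_elim
        case (elim N)
        have "2 * real (N div 2) \<le> real N" by linarith
        with elim show ?case by (simp add: field_simps)
      qed
      have "(\<lambda>N. 1 / 2 - inverse (real N)) \<longlonglongrightarrow> 1 / 2 - 0"
        by (intro tendsto_intros lim_inverse_n)
      then show "(\<lambda>N. 1 / 2 - inverse (real N)) \<longlonglongrightarrow> 1 / 2" by simp
    qed simp
    ultimately have "(\<lambda>N. (h (N div 2) / real (N div 2)) * (real (N div 2) / real N)) \<longlonglongrightarrow> L * (1 / 2)"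
      by (rule tendsto_mult)
    moreover have "\<forall>\<^sub>F N in sequentially.
      (h (N div 2) / real (N div 2)) * (real (N div 2) / real N) = h (N div 2) / real N"
      using eventually_ge_at_top[of 2]
    proof eventually_elim
      case (elim N)
      then have "N div 2 > 0" by linarith
      then show ?case by simp
    qed
    ultimately show ?thesis by (simp add: Lim_transform_eventually)
  qed
  have F: "(\<lambda>N. f (N div 2) / real N) \<longlonglongrightarrow> l / 2"
    using assms(1) by (intro half) (simp add: has_density_def f_def)
  have g_lim: "(\<lambda>N. g N / real N) \<longlonglongrightarrow> m"
    using assms(2) by (simp add: has_density_def g_def)
  have G: "(\<lambda>N. (g (N div 2) - (if even N \<and> P (Suc N) then 1 else 0)) / real N) \<longlonglongrightarrow> m / 2 - 0"
    unfolding diff_divide_distrib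
  proof (intro tendsto_diff half g_lim)
    show "(\<lambda>N. (if even N \<and> P (Suc N) then 1 else 0) / real N) \<longlonglongrightarrow> 0"
      by (rule tendsto_sandwich[OF _ _ tendsto_const lim_inverse_n])
         (auto simp: field_simps intro!: always_eventually)
  qed
  have count: "real (card {x. x \<le> N \<and> P x})
      = f (N div 2) + (g (N div 2) - (if even N \<and> P (Suc N) then 1 else 0))" for N
  proof -
    define C where "C = {y. Suc (2 * y) \<le> N \<and> P (Suc (2 * y))}"
    have finC: "finite C"
      by (rule finite_subset[of _ "{..N}"]) (auto simp: C_def)
    have "{x. x \<le> N \<and> P x} = (\<lambda>y. 2 * y) ` {y. y \<le> N div 2 \<and> P (2 * y)} \<union> (\<lambda>y. Suc (2 * y)) ` C"
    proof (rule set_eqI)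
      fix x
      show "x \<in> {x. x \<le> N \<and> P x} \<longleftrightarrow>
        x \<in> (\<lambda>y. 2 * y) ` {y. y \<le> N div 2 \<and> P (2 * y)} \<union> (\<lambda>y. Suc (2 * y)) ` C"
      proof (cases "even x")
        case True
        then obtain y where "x = 2 * y" by (elim evenE)
        then show ?thesis by (auto simp: image_iff) presburger+
      next
        case False
        then obtain y where "x = Suc (2 * y)" by (metis oddE Suc_eq_plus1)
        then show ?thesis by (auto simp: image_iff C_def)
      qed
    qed
    moreover have "(\<lambda>y. 2 * y) ` {y. y \<le> N div 2 \<and> P (2 * y)} \<inter> (\<lambda>y. Suc (2 * y)) ` C = {}"
      by auto presburger
    ultimately have "card {x. x \<le> N \<and> P x} = card {y. y \<le> N div 2 \<and> P (2 * y)} + card C"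
      using finC by (simp add: card_Un_disjoint card_image inj_on_def)
    moreover have "{y. y \<le> N div 2 \<and> P (Suc (2 * y))} =
        (if even N \<and> P (Suc N) then insert (N div 2) C else C)"
    proof (cases "even N")
      case True
      then obtain M where "N = 2 * M" by (elim evenE)
      then show ?thesis by (auto simp: C_def le_less)
    next
      case False
      then obtain M where "N = Suc (2 * M)" by (metis oddE Suc_eq_plus1)
      then show ?thesis by (auto simp: C_def)
    qed
    moreover have "N div 2 \<notin> C" if "even N"
      using that by (auto simp: C_def)
    ultimately show ?thesis
      using finC by (auto simp: f_def g_def)
  qed
  have "(\<lambda>N. f (N div 2) / real N + (g (N div 2) - (if even N \<and> P (Suc N) then 1 else 0)) / real N)
      \<longlonglongrightarrow> l / 2 + (m / 2 - 0)"
    by (rule tendsto_add[OF F G])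
  then show ?thesis
    by (simp add: has_density_def count add_divide_distrib)
qed

lemma s2_Suc_le: "s2 (Suc x) \<le> Suc (s2 x)"
proof (induction x rule: less_induct)
  case (less x)
  show ?case
  proof (cases "even x")
    case True
    then obtain y where "x = 2 * y" by (elim evenE)
    then show ?thesis by simp
  next
    case False
    then obtain y where y: "x = Suc (2 * y)" by (metis oddE Suc_eq_plus1)
    have "s2 (Suc x) = s2 (2 * Suc y)" by (simp add: y)
    also have "\<dots> = s2 (Suc y)" by (rule s2_double)
    also have "\<dots> \<le> Suc (s2 y)" using less.IH[of y] y by simp
    finally show ?thesis by (simp add: y)
  qed
qed

lemma has_density_digit_difference_even:
  assumes "has_density (\<lambda>x. int (s2 (x + b)) - int (s2 x) = d) l"
  shows "has_density (\<lambda>x. int (s2 (x + 2 * b)) - int (s2 x) = d) l"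
proof -
  have "has_density (\<lambda>x. int (s2 (x + 2 * b)) - int (s2 x) = d) ((l + l) / 2)"
  proof (rule has_density_split)
    have "s2 (2 * y + 2 * b) = s2 (y + b)" "s2 (Suc (2 * y) + 2 * b) = Suc (s2 (y + b))" for y
      using s2_double[of "y + b"] s2_double_Suc[of "y + b"] by (simp_all add: algebra_simps)
    with assms show "has_density (\<lambda>y. int (s2 (2 * y + 2 * b)) - int (s2 (2 * y)) = d) l"
      "has_density (\<lambda>y. int (s2 (Suc (2 * y) + 2 * b)) - int (s2 (Suc (2 * y))) = d) l"
      by simp_all
  qed
  then show ?thesis by simp
qed

lemma has_density_digit_difference_odd:
  assumes "has_density (\<lambda>x. int (s2 (x + b)) - int (s2 x) = d - 1) l"
    and "has_density (\<lambda>x. int (s2 (x + Suc b)) - int (s2 x) = d + 1) m"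
  shows "has_density (\<lambda>x. int (s2 (x + Suc (2 * b))) - int (s2 x) = d) ((l + m) / 2)"
proof (rule has_density_split)
  have e: "s2 (2 * y + Suc (2 * b)) = Suc (s2 (y + b))" 
    "s2 (Suc (2 * y) + Suc (2 * b)) = s2 (y + Suc b)" for y
    using s2_double_Suc[of "y + b"] s2_double[of "y + Suc b"] by (simp_all add: algebra_simps)
  have "(int (s2 (2 * y + Suc (2 * b))) - int (s2 (2 * y)) = d)
      = (int (s2 (y + b)) - int (s2 y) = d - 1)" for y
    unfolding e by auto
  with assms(1) show "has_density (\<lambda>y. int (s2 (2 * y + Suc (2 * b))) - int (s2 (2 * y)) = d) l"
    by simp
  have "(int (s2 (Suc (2 * y) + Suc (2 * b))) - int (s2 (Suc (2 * y))) = d)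
      = (int (s2 (y + Suc b)) - int (s2 y) = d + 1)" for y
    unfolding e by auto
  with assms(2) show "has_density
      (\<lambda>y. int (s2 (Suc (2 * y) + Suc (2 * b))) - int (s2 (Suc (2 * y))) = d) m"
    by simp
qed

lemma has_density_digit_difference_0:
  "has_density (\<lambda>x. int (s2 (x + 0)) - int (s2 x) = d) (if d = 0 then 1 else 0)"
  using has_density_True has_density_False by (cases "d = 0") auto

lemma has_density_digit_difference_exists:
  "\<exists>l. has_density (\<lambda>x. int (s2 (x + a)) - int (s2 x) = d) l"
proof (induction a arbitrary: d rule: less_induct)
  case (less a)
  consider "a = 0" | "a = 1" | b where "a = 2 * b" "b > 0" | b where "a = Suc (2 * b)" "b > 0"
    by (metis One_nat_def Suc_eq_plus1 evenE mult_0_right neq0_conv oddE)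
  then show ?case
  proof cases
    case 1
    then show ?thesis using has_density_digit_difference_0 by blast
  next
    case 2
    have "\<exists>l. has_density (\<lambda>x. int (s2 (x + Suc 0)) - int (s2 x) = d) l"
    proof (cases "d \<ge> 2")
      case True
      have "int (s2 (x + Suc 0)) - int (s2 x) \<noteq> d" for x
        using s2_Suc_le[of x] True by simp
      then show ?thesis using has_density_False by auto
    next
      case False
      then have "d \<le> 2" by simp
      then show ?thesis
      proof (induction d rule: int_le_induct)
        case base
        have "int (s2 (x + Suc 0)) - int (s2 x) \<noteq> 2" for x
          using s2_Suc_le[of x] by simp
        then show ?case using has_density_False by auto
      next
        case (step d)
        then obtain m where "has_density (\<lambda>x. int (s2 (x + Suc 0)) - int (s2 x) = d) m" by blast
        then show ?case
          using has_density_digit_difference_odd[of 0 "d - 1", OF has_density_digit_difference_0, of m]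
          by auto
      qed
    qed
    then show ?thesis by (simp add: 2)
  next
    case (3 b)
    then show ?thesis using less.IH[of b d] has_density_digit_difference_even by auto
  next
    case (4 b)
    then show ?thesis
      using less.IH[of b "d - 1"] less.IH[of "Suc b" "d + 1"] has_density_digit_difference_odd[of b d]
      by fastforce
  qed
qed

text \<open>The limit defining \<^const>\<open>mu\<close> exists, so \<^const>\<open>lim\<close> never takes a junk value there.\<close>

lemma mu_LIMSEQ:
  "(\<lambda>N. real (card {x. x \<le> N \<and> int (s2 (x + a)) - int (s2 x) = d}) / real N) \<longlonglongrightarrow> mu a d"
  using has_density_digit_difference_exists[of a d] unfolding has_density_def mu_def
  by (simp add: convergent_LIMSEQ_iff[symmetric] convergent_def)

lemma mu_nonneg: "mu a d \<ge> 0"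
  by (rule tendsto_lowerbound[OF mu_LIMSEQ]) auto

lemma sum_mu_le_1:
  assumes "finite F"
  shows "(\<Sum>d\<in>F. mu a d) \<le> 1"
proof (rule tendsto_le[OF sequentially_bot])
  show "(\<lambda>N. \<Sum>d\<in>F. real (card {x. x \<le> N \<and> int (s2 (x + a)) - int (s2 x) = d}) / real N)
      \<longlonglongrightarrow> (\<Sum>d\<in>F. mu a d)"
    by (intro tendsto_sum mu_LIMSEQ)
  show "(\<lambda>N. real (card {x. x \<le> N \<and> True}) / real N) \<longlonglongrightarrow> 1"
    using has_density_True by (simp only: has_density_def)
  have "(\<Sum>d\<in>F. real (card {x. x \<le> N \<and> int (s2 (x + a)) - int (s2 x) = d}))
      \<le> real (card {x. x \<le> N \<and> True})" for N
  proof -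
    have "(\<Sum>d\<in>F. card {x. x \<le> N \<and> int (s2 (x + a)) - int (s2 x) = d})
        = card (\<Union>d\<in>F. {x. x \<le> N \<and> int (s2 (x + a)) - int (s2 x) = d})"
      using assms by (subst card_UN_disjoint) auto
    also have "\<dots> \<le> card {x. x \<le> N \<and> True}"
      by (rule card_mono) auto
    finally show ?thesis by (simp only: of_nat_sum[symmetric] of_nat_le_iff)
  qed
  then show "\<forall>\<^sub>F N in sequentially.
      (\<Sum>d\<in>F. real (card {x. x \<le> N \<and> int (s2 (x + a)) - int (s2 x) = d}) / real N)
      \<le> real (card {x. x \<le> N \<and> True}) / real N"
    by (intro always_eventually allI) (simp only: sum_divide_distrib[symmetric], rule divide_right_mono, auto)
qed

lemma mu_in_l1: "(\<lambda>d. \<bar>mu a d\<bar>) summable_on UNIV"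
  by (rule nonneg_bdd_above_summable_on) (auto simp: mu_nonneg sum_mu_le_1 intro!: bdd_aboveI[of _ 1])

end

theory Submission
  imports Defs
begin

text \<open>
  Splitting \<open>x\<close> by parity gives \<open>\<mu>\<^bsub>2b\<^esub> = \<mu>\<^sub>b\<close> and
  \<open>\<mu>\<^bsub>2b+1\<^esub> = (S\<^sup>-\<^sup>1 \<mu>\<^sub>b + S \<mu>\<^bsub>b+1\<^esub>) / 2\<close>, so the row
  \<open>(\<mu>\<^bsub>a\<^esub>, \<mu>\<^bsub>a+1\<^esub>)\<close> arises from \<open>(\<mu>\<^sub>b, \<mu>\<^bsub>b+1\<^esub>)\<close>, where \<open>b = a div 2\<close>, by multiplying
  on the right by the matrix of the lowest digit of \<open>a\<close>. The rows
  \<open>(Id, Id) A\<^bsub>a\<^sub>n\<^esub> \<dots> A\<^bsub>a\<^sub>0\<^esub>\<close>, evaluated entrywise at \<open>\<delta>\<^sub>0\<close>, obey the same recursion, so by strong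
  induction on \<open>a\<close> they converge to \<open>(\<mu>\<^bsub>a\<^esub>, \<mu>\<^bsub>a+1\<^esub>)\<close>. For \<open>a = 0\<close> the recursion leads back to
  \<open>a = 0\<close>, but it halves the distance to the limit.
\<close>

lemma op_mult_assoc: "(A \<odot> B) \<odot> C = A \<odot> (B \<odot> C)"
  unfolding op_mult_def vec_eq_iff
  by (auto intro!: blinfun_eqI simp: sum_2 blinfun.add_left blinfun.add_right)

text \<open>\<open>A_prod\<close> grows on the left, by the highest digit. Peeling off the lowest
  digit on the right instead makes recursion along \<open>a div 2\<close> possible, since bit
  \<open>n\<close> of \<open>a div 2\<close> is bit \<open>Suc n\<close> of
  \<open>a\<close>.\<close>

lemma A_prod_Suc_right: "A_prod a (Suc n) = A_prod (a div 2) n \<odot> A_digit a 0"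
proof (induction n)
  case 0
  show ?case by (simp add: A_digit_def bit_Suc)
next
  case (Suc n)
  have "A_prod a (Suc (Suc n)) = A_digit (a div 2) (Suc n) \<odot> (A_prod (a div 2) n \<odot> A_digit a 0)"
    by (subst A_prod.simps(2), subst Suc.IH) (simp add: A_digit_def bit_Suc)
  then show ?case by (simp add: op_mult_assoc)
qed

definition row_op :: "nat \<Rightarrow> nat \<Rightarrow> 2 \<Rightarrow> l1Z \<Rightarrow>\<^sub>L l1Z"
  where "row_op a n j = A_prod a n $ 1 $ j + A_prod a n $ 2 $ j"

lemma row_Id_Id_A_prod:
  "row_Id_Id (A_prod a n \<odot>v vector [u, v]) = row_op a n 1 u + row_op a n 2 v"
  by (simp add: row_Id_Id_def op_apply_def row_op_def sum_2 blinfun.add_left)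

lemma row_op_Suc_even:
  "row_op (2 * b) (Suc n) 1 u = row_op b n 1 u"
  "row_op (2 * b) (Suc n) 2 u = (1/2) *\<^sub>R (row_op b n 1 (shift_inv u) + row_op b n 2 (shift u))"
  unfolding row_op_def A_prod_Suc_right
  by (simp_all add: A_digit_def bit_0 op_mult_def A0_def sum_2 blinfun.add_left
      blinfun.scaleR_left blinfun.scaleR_right algebra_simps)

lemma row_op_Suc_odd:
  "row_op (Suc (2 * b)) (Suc n) 1 u = (1/2) *\<^sub>R (row_op b n 1 (shift_inv u) + row_op b n 2 (shift u))"
  "row_op (Suc (2 * b)) (Suc n) 2 u = row_op b n 2 u"
  unfolding row_op_def A_prod_Suc_right
  by (simp_all add: A_digit_def bit_0 op_mult_def A1_def sum_2 blinfun.add_left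
      blinfun.scaleR_left blinfun.scaleR_right algebra_simps)

lemma shift_shift_inv [simp]: "shift (shift_inv u) = u" "shift_inv (shift u) = u"
  using shift_inv_inverse by (metis blinfun_apply_blinfun_compose id_blinfun.rep_eq)+

text \<open>Both entries are polynomials in \<open>shift\<close> and \<open>shift_inv\<close>, so
  they commute with \<open>shift\<close>. This turns the shifts in the recursion into translations
  of \<open>d\<close>.\<close>

lemma row_op_shift: "row_op a n 1 (shift u) = shift (row_op a n 1 u) \<and>
  row_op a n 2 (shift u) = shift (row_op a n 2 u)"
proof (induction n arbitrary: a u)
  case 0
  show ?case
    by (simp add: row_op_def A_digit_def A0_def A1_def blinfun.add_left blinfun.add_right
        blinfun.scaleR_left blinfun.scaleR_right)
next
  case (Suc n)
  \<comment> \<open>The recursion also feeds \<open>shift_inv u\<close> to the first entry; here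
    \<open>shift\<close> cancels it.\<close>
  have "row_op b n 1 u = shift (row_op b n 1 (shift_inv u))" for b
    using Suc.IH[of b "shift_inv u"] by simp
  then show ?case
    using Suc.IH
    by (cases "even a")
      (auto elim!: evenE oddE simp: row_op_Suc_even row_op_Suc_odd blinfun.add_right
        blinfun.scaleR_right)
qed

lemma row_op_shift_inv: "row_op a n 1 (shift_inv u) = shift_inv (row_op a n 1 u)"
  using row_op_shift[of a n "shift_inv u"] by (metis shift_shift_inv)

lemma mu_eqI: "has_density (\<lambda>x. int (s2 (x + a)) - int (s2 x) = d) l \<Longrightarrow> mu a d = l"
  unfolding has_density_def using mu_LIMSEQ LIMSEQ_unique by blast

lemma has_density_mu: "has_density (\<lambda>x. int (s2 (x + a)) - int (s2 x) = d) (mu a d)"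
  unfolding has_density_def by (rule mu_LIMSEQ)

lemma mu_0: "mu 0 d = (if d = 0 then 1 else 0)"
  by (rule mu_eqI has_density_digit_difference_0)+

lemma mu_even: "mu (2 * b) d = mu b d"
  by (rule mu_eqI has_density_digit_difference_even has_density_mu)+

lemma mu_odd: "mu (Suc (2 * b)) d = (mu b (d - 1) + mu (Suc b) (d + 1)) / 2"
  by (rule mu_eqI has_density_digit_difference_odd has_density_mu)+

definition entry :: "nat \<Rightarrow> nat \<Rightarrow> 2 \<Rightarrow> int \<Rightarrow> real"
  where "entry a n j d = l1_nth (row_op a n j delta0) d"

lemma entry_Suc_even:
  "entry (2 * b) (Suc n) 1 d = entry b n 1 d"
  "entry (2 * b) (Suc n) 2 d = (entry b n 1 (d - 1) + entry b n 2 (d + 1)) / 2"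
  by (simp_all add: entry_def row_op_Suc_even row_op_shift row_op_shift_inv scaleR_l1Z.rep_eq
      plus_l1Z.rep_eq l1_nth_shift l1_nth_shift_inv)

lemma entry_Suc_odd:
  "entry (Suc (2 * b)) (Suc n) 1 d = (entry b n 1 (d - 1) + entry b n 2 (d + 1)) / 2"
  "entry (Suc (2 * b)) (Suc n) 2 d = entry b n 2 d"
  by (simp_all add: entry_def row_op_Suc_odd row_op_shift row_op_shift_inv scaleR_l1Z.rep_eq
      plus_l1Z.rep_eq l1_nth_shift l1_nth_shift_inv)

text \<open>The first column of \<open>A0\<close> is \<open>(Id, 0)\<close>, so every power of
  \<open>A0\<close> fixes \<open>(delta0, 0)\<close>.\<close>

lemma entry_0_1: "entry 0 n 1 d = mu 0 d"
proof (induction n)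
  case 0
  show ?case by (simp add: entry_def row_op_def A_digit_def A0_def delta0.rep_eq mu_0)
next
  case (Suc n)
  then show ?case using entry_Suc_even(1)[of 0] by simp
qed

lemma entry_0_2_error: "\<bar>entry 0 n 2 d - mu 1 d\<bar> \<le> (1/2) ^ n"
proof (induction n arbitrary: d)
  case 0
  \<comment> \<open>For \<open>n = 0\<close> the entry is 1/2 at \<open>d = 1\<close> and
    \<open>d = -1\<close>, and 0 elsewhere.\<close>
  have "0 \<le> entry 0 0 2 d" "entry 0 0 2 d \<le> 1"
    by (simp_all add: entry_def row_op_def A_digit_def A0_def delta0.rep_eq blinfun.add_left
        blinfun.scaleR_left scaleR_l1Z.rep_eq plus_l1Z.rep_eq l1_nth_shift l1_nth_shift_inv)
  moreover have "0 \<le> mu 1 d" "mu 1 d \<le> 1"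
    using mu_nonneg[of 1 d] sum_mu_le_1[of "{d}" 1] by simp_all
  ultimately show ?case by simp
next
  case (Suc n)
  \<comment> \<open>\<open>mu 1\<close> satisfies the same recursion, and the first-entry terms
    cancel because they are exact for every \<open>n\<close>.\<close>
  have "entry 0 (Suc n) 2 d - mu 1 d = (entry 0 n 2 (d + 1) - mu 1 (d + 1)) / 2"
    using entry_Suc_even(2)[of 0 n d] mu_odd[of 0 d] by (simp add: entry_0_1 field_simps)
  then show ?case using Suc.IH[of "d + 1"] by (simp only: abs_divide power_Suc) simp
qed

lemma entry_0_2_LIMSEQ: "(\<lambda>n. entry 0 n 2 d) \<longlonglongrightarrow> mu 1 d"
proof (rule LIM_zero_cancel, rule Lim_null_comparison)
  show "\<forall>\<^sub>F n in sequentially. norm (entry 0 n 2 d - mu 1 d) \<le> (1/2) ^ n"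
    using entry_0_2_error by (intro always_eventually) (simp only: real_norm_def, blast)
qed (rule LIMSEQ_power_zero, simp)

lemma entry_LIMSEQ:
  "(\<lambda>n. entry a n 1 d) \<longlonglongrightarrow> mu a d \<and> (\<lambda>n. entry a n 2 d) \<longlonglongrightarrow> mu (Suc a) d"
proof (induction a arbitrary: d rule: less_induct)
  case (less a)
  show ?case
  proof (cases "a = 0")
    case True
    then show ?thesis using entry_0_2_LIMSEQ by (simp add: entry_0_1)
  next
    case False
    define b where "b = a div 2"
    have "b < a" using False by (simp add: b_def)
    then have lim1: "(\<lambda>n. entry b n 1 e) \<longlonglongrightarrow> mu b e"
      and lim2: "(\<lambda>n. entry b n 2 e) \<longlonglongrightarrow> mu (Suc b) e" for e
      using less.IH by blast+
    have lim_avg: "(\<lambda>n. (entry b n 1 (d - 1) + entry b n 2 (d + 1)) / 2) \<longlonglongrightarrow> mu (Suc (2 * b)) d"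
      unfolding mu_odd by (intro tendsto_intros lim1 lim2) simp
    have "(\<lambda>n. entry a (Suc n) 1 d) \<longlonglongrightarrow> mu a d \<and> (\<lambda>n. entry a (Suc n) 2 d) \<longlonglongrightarrow> mu (Suc a) d"
    proof (cases "even a")
      case True
      then have "a = 2 * b" by (simp add: b_def)
      then show ?thesis using lim1 lim_avg by (simp add: entry_Suc_even mu_even)
    next
      case False
      then have "a = Suc (2 * b)" by (simp add: b_def)
      \<comment> \<open>Here \<open>Suc a = 2 * Suc b\<close>, so the second limit
        \<open>mu (Suc b) d\<close> equals \<open>mu (Suc a) d\<close>.\<close>
      then show ?thesis using lim2 lim_avg mu_even[of "Suc b" d] by (simp add: entry_Suc_odd)
    qed
    then show ?thesis
      using LIMSEQ_imp_Suc[of "\<lambda>n. entry a n 1 d"] LIMSEQ_imp_Suc[of "\<lambda>n. entry a n 2 d"] by simp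
  qed
qed

theorem theorem1:
  fixes a :: nat
  shows "\<forall>d :: int.
    (\<lambda>n. l1_nth (row_Id_Id (A_prod a n \<odot>v vector [delta0, 0])) d) \<longlonglongrightarrow> mu a d"
  using entry_LIMSEQ[of a] by (simp add: row_Id_Id_A_prod entry_def)

end
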